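(* Consider the Dirac-type system $$\Big(\frac{d}{dr}+a(r)\Big)f-\big(\lambda+m-b(r)\big)g=0,\qquad \Big(\frac{d}{dr}-a(r)\Big)g+\big(\lambda-m-b(r)\big)f=0\qquad(m>0),$$ with real-valued $a,b$ satisfying the conditions (i) and (ii) listed in the context. Its stationary deviation factor is $$V_0(r,\lambda)=\exp\Big(\mathrm{i}\frac{\lambda}{\eta}\int_1^r b(u)\,du\Big)I_2,\qquad \eta=\sqrt{\lambda^2-m^2},$$ and its dynamical deviation factor in the momentum representation is $$\widetilde W_0(t,p)=\exp\Big(\mathrm{i}\,\mathrm{sgn}(t)\int_1^{|t|}b(rs)\,dr\Big)I_2,\qquad s=\frac{p}{\sqrt{p^2+m^2}} .$$ The two deviation factors are connected by the equality $$V_0\big(ts,\sqrt{p^2+m^2}\,\big)=\mathcal{C}(p)\,\widetilde W_0(t,p)\qquad(t>0),$$ where $|\mathcal{C}(p)|=1$.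
   Context: $I_2$ is the $2\times2$ identity matrix; $p$ is the momentum variable; $a$ and $b$ are extended to negative arguments by $a(-r)=a(r)$, $b(-r)=b(r)$. (i) (Condition for $V_0$ to be the stationary deviation factor, i.e. to describe the deviation of the solutions from free waves as $r\to\infty$.) $$\int_1^\infty|b'|\,dr+\int_1^\infty|b|^2\,dr+\int_0^1|b|\,dr<\infty,\qquad \int_1^\infty|a'|\,dr+\int_1^\infty|a|^2\,dr+\int_0^\infty|a|\,dr<\infty .$$ (ii) (Condition for $\widetilde W_0$ to be the dynamical deviation factor, i.e. the one used in the generalized wave operators as $t\to\pm\infty$.) For $r>0$, $\nu=0,1,2$ and fixed $\alpha,\gamma$: $$|a^{(\nu)}(r)|+|b^{(\nu)}(r)|\le C(1+r)^{-\alpha-\nu},\quad 3/4<\alpha<1;\qquad |a(r)|<C(1+r)^{-1-\alpha+\gamma},\quad 1-\alpha<\gamma<\alpha-1/2 .$$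
   Formalization: For p < 0 the stationary factor is taken with η = −√(λ²−m²) = p, since with the nonnegative root the ratio of the two factors depends on t; p = 0 is excluded, since η = 0 there and V_0 is undefined. *)

theory Defs
  imports "HOL-Analysis.Analysis"
begin

(* Fixes the sign conventions behind the deviation factors below; in those, a does not occur
   (it is absolutely integrable), and the system enters only through m and b. *)
definition dirac_solution ::
  "real \<Rightarrow> (real \<Rightarrow> real) \<Rightarrow> (real \<Rightarrow> real) \<Rightarrow> real \<Rightarrow> (real \<Rightarrow> complex) \<Rightarrow> (real \<Rightarrow> complex) \<Rightarrow> bool"
  where
  "dirac_solution m a b lam f g \<longleftrightarrow>
     (\<forall>r>0. (\<exists>f' g'. (f has_vector_derivative f') (at r) \<and> (g has_vector_derivative g') (at r) \<and>
        f' + of_real (a r) * f r - of_real (lam + m - b r) * g r = 0 \<and>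
        g' - of_real (a r) * g r + of_real (lam - m - b r) * f r = 0))"

definition even_fun :: "(real \<Rightarrow> real) \<Rightarrow> bool" where
  "even_fun f \<longleftrightarrow> (\<forall>r. f (- r) = f r)"

definition twice_differentiable_pos :: "(real \<Rightarrow> real) \<Rightarrow> bool" where
  "twice_differentiable_pos f \<longleftrightarrow> (\<forall>r>0. f differentiable (at r) \<and> deriv f differentiable (at r))"

definition stationary_condition :: "(real \<Rightarrow> real) \<Rightarrow> (real \<Rightarrow> real) \<Rightarrow> bool" where
  "stationary_condition a b \<longleftrightarrow>
     set_integrable lborel {1..} (\<lambda>r. \<bar>deriv b r\<bar>) \<and>
     set_integrable lborel {1..} (\<lambda>r. \<bar>b r\<bar>\<^sup>2) \<and>
     set_integrable lborel {0<..1} (\<lambda>r. \<bar>b r\<bar>) \<and>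
     set_integrable lborel {1..} (\<lambda>r. \<bar>deriv a r\<bar>) \<and>
     set_integrable lborel {1..} (\<lambda>r. \<bar>a r\<bar>\<^sup>2) \<and>
     set_integrable lborel {0<..} (\<lambda>r. \<bar>a r\<bar>)"

definition dynamical_condition ::
  "real \<Rightarrow> real \<Rightarrow> (real \<Rightarrow> real) \<Rightarrow> (real \<Rightarrow> real) \<Rightarrow> bool" where
  "dynamical_condition \<alpha> \<gamma> a b \<longleftrightarrow>
     3 / 4 < \<alpha> \<and> \<alpha> < 1 \<and> 1 - \<alpha> < \<gamma> \<and> \<gamma> < \<alpha> - 1 / 2 \<and>
     twice_differentiable_pos a \<and> twice_differentiable_pos b \<and>
     (\<exists>C. \<forall>r>0.
        (\<forall>\<nu>\<in>{0, 1, 2::nat}.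
           \<bar>(deriv ^^ \<nu>) a r\<bar> + \<bar>(deriv ^^ \<nu>) b r\<bar> \<le> C * (1 + r) powr (- \<alpha> - real \<nu>)) \<and>
        \<bar>a r\<bar> < C * (1 + r) powr (- 1 - \<alpha> + \<gamma>))"

(* The scalar matrix c I_2 is mat c.  The integrals are oriented: the upper limit may be
   smaller than the lower one, and negative. *)
definition deviation_factor :: "real \<Rightarrow> (real \<Rightarrow> real) \<Rightarrow> real \<Rightarrow> real \<Rightarrow> complex^2^2" where
  "deviation_factor \<eta> b r lam = mat (exp (\<i> * of_real (lam / \<eta> * (LBINT u=1..r. b u))))"

definition V0 :: "real \<Rightarrow> (real \<Rightarrow> real) \<Rightarrow> real \<Rightarrow> real \<Rightarrow> complex^2^2" where
  "V0 m b r lam = deviation_factor (sqrt (lam\<^sup>2 - m\<^sup>2)) b r lam"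

(* The other branch of the square root.  At lam = sqrt (p^2 + m^2) the two branches are |p| and
   - |p|, so this is the one with \<eta> = p, i.e. lam / \<eta> = 1 / s, when the momentum p is negative. *)
definition V0_minus :: "real \<Rightarrow> (real \<Rightarrow> real) \<Rightarrow> real \<Rightarrow> real \<Rightarrow> complex^2^2" where
  "V0_minus m b r lam = deviation_factor (- sqrt (lam\<^sup>2 - m\<^sup>2)) b r lam"

definition velocity :: "real \<Rightarrow> real \<Rightarrow> real" where
  "velocity m p = p / sqrt (p\<^sup>2 + m\<^sup>2)"

definition W0 :: "real \<Rightarrow> (real \<Rightarrow> real) \<Rightarrow> real \<Rightarrow> real \<Rightarrow> complex^2^2" where
  "W0 m b t p =
     mat (exp (\<i> * of_real (sgn t * (LBINT r=1..\<bar>t\<bar>. b (r * velocity m p)))))"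

end

theory Submission
  imports Defs
begin

text \<open>
  With \<open>s = p / sqrt (p\<^sup>2 + m\<^sup>2)\<close> the exponent of the stationary factor at \<open>r = t s\<close> is
  \<open>1/s\<close> times the integral of \<open>b\<close> from \<open>1\<close> to \<open>t s\<close>, while the substitution \<open>u = r s\<close> turns the
  exponent of the dynamical factor into \<open>1/s\<close> times the integral of \<open>b\<close> from \<open>s\<close> to \<open>t s\<close>. The
  two differ by \<open>1/s\<close> times the integral from \<open>1\<close> to \<open>s\<close>, which is real and independent of \<open>t\<close>.
\<close>

text \<open>The affine change of variables for the Lebesgue integral needs no regularity of
  \<open>f\<close>: without integrability both sides are 0. It produces the factor
  \<open>\<bar>c\<bar>\<close>; for negative \<open>c\<close> the map reverses the interval, and the
  orientation sign turns \<open>\<bar>c\<bar>\<close> back into \<open>c\<close>.\<close>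

lemma interval_integral_mult_right_substitution:
  fixes f :: "real \<Rightarrow> real" and c x y :: real
  assumes c: "c \<noteq> 0"
  shows "c * (LBINT r=x..y. f (r * c)) = (LBINT u=x * c..y * c. f u)"
proof (induct x y rule: linorder_wlog)
  case (le x y)
  have scale: "(LBINT u:S. f u) = \<bar>c\<bar> * (LBINT r:T. f (r * c))"
    if "\<And>r. r * c \<in> S \<longleftrightarrow> r \<in> T" for S T :: "real set"
  proof -
    have "(LBINT u:S. f u) = \<bar>c\<bar> * (LBINT r. indicator S (r * c) * f (r * c))"
      unfolding set_lebesgue_integral_def
      using lborel_integral_real_affine[OF c, of "\<lambda>u. indicator S u * f u" 0]
      by (simp add: mult.commute)
    then show ?thesis
      using that by (simp add: set_lebesgue_integral_def indicator_def)
  qed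
  show ?case
  proof (cases "c > 0")
    case True
    have "r * c \<in> {x * c<..<y * c} \<longleftrightarrow> r \<in> {x<..<y}" for r
      using True by simp
    from scale[OF this] show ?thesis
      using True le by (simp add: interval_lebesgue_integral_def)
  next
    case False
    then have neg: "c < 0"
      using c by simp
    have "r * c \<in> {y * c<..<x * c} \<longleftrightarrow> r \<in> {x<..<y}" for r
      using neg by auto
    from scale[OF this] have "(LBINT u=y * c..x * c. f u) = - c * (LBINT r=x..y. f (r * c))"
      using neg le by (simp add: interval_lebesgue_integral_def)
    then show ?thesis
      using interval_integral_endpoints_reverse[of "x * c" "y * c" f] by simp
  qed
next
  case (sym x y)
  then show ?case
    using interval_integral_endpoints_reverse[of x y "\<lambda>r. f (r * c)"]
      interval_integral_endpoints_reverse[of "x * c" "y * c" f] by simp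
qed

text \<open>For negative momentum the path from 1 to \<open>t * s\<close> crosses 0, where nothing
  is known about the potential. A single point is Lebesgue-null and affects neither measurability
  nor the almost-everywhere bound.\<close>

lemma interval_integrable_bounded_punctured:
  fixes f :: "real \<Rightarrow> real" and x y :: real
  assumes cont: "continuous_on (- {0}) f" and bnd: "\<And>u. u \<noteq> 0 \<Longrightarrow> \<bar>f u\<bar> \<le> B"
  shows "interval_lebesgue_integrable lborel x y f"
proof -
  have meas: "f \<in> borel_measurable borel"
    by (rule borel_measurable_continuous_countable_exceptions[OF _ cont]) simp
  have "set_integrable lborel {v<..<w} f" for v w :: real
    unfolding set_integrable_def
  proof (rule integrableI_bounded_set_indicator)
    show "AE u in lborel. u \<in> {v<..<w} \<longrightarrow> norm (f u) \<le> B"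
      using AE_lborel_singleton[of 0] by eventually_elim (simp add: bnd)
    show "emeasure lborel {v<..<w} < \<infinity>"
      by (rule emeasure_bounded_finite) simp
  qed (use meas in simp_all)
  then show ?thesis
    by (simp add: interval_lebesgue_integrable_def)
qed

text \<open>Differentiability gives continuity on the positive half-line, and the reflection
  \<open>v \<mapsto> - v\<close> carries it to the negative one.\<close>

lemma even_fun_continuous_on_punctured:
  assumes even: "even_fun f" and diff: "twice_differentiable_pos f"
  shows "continuous_on (- {0}) f"
proof -
  have pos: "isCont f u" if "u > 0" for u
    using diff that by (simp add: twice_differentiable_pos_def differentiable_imp_continuous_within)
  have "isCont f u" if "u \<noteq> 0" for u
  proof (cases "u > 0")
    case False
    have "isCont (\<lambda>v. f (- v)) u"
      by (rule isCont_o2[where g = f]) (use pos[of "- u"] False that in auto)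
    then show ?thesis
      using even by (simp add: even_fun_def)
  qed (rule pos)
  then show ?thesis
    by (simp add: continuous_at_imp_continuous_on)
qed

text \<open>This is the decay estimate for \<nu> = 0: as \<alpha> is positive, the weight is at most
  1 for r > 0, and evenness covers negative arguments.\<close>

lemma dynamical_condition_bounded:
  assumes even: "even_fun b" and dyn: "dynamical_condition \<alpha> \<gamma> a b"
  obtains B where "\<And>u. u \<noteq> 0 \<Longrightarrow> \<bar>b u\<bar> \<le> B"
proof -
  obtain C where \<alpha>: "\<alpha> > 3 / 4"
    and C: "\<And>r. r > 0 \<Longrightarrow> \<bar>a r\<bar> + \<bar>b r\<bar> \<le> C * (1 + r) powr (- \<alpha>)"
    using dyn unfolding dynamical_condition_def by force
  \<comment> \<open>The sign of \<open>C\<close> is read off from the estimate at r = 1.\<close>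
  have "0 \<le> C * 2 powr (- \<alpha>)"
    using C[of 1] by (smt (verit) abs_ge_zero one_add_one)
  then have "C \<ge> 0"
    by (simp add: zero_le_mult_iff)
  have pos: "\<bar>b r\<bar> \<le> C" if "r > 0" for r
  proof -
    have "(1 + r) powr (- \<alpha>) \<le> (1 + r) powr 0"
      by (rule powr_mono) (use \<alpha> that in auto)
    then have "C * (1 + r) powr (- \<alpha>) \<le> C"
      using \<open>C \<ge> 0\<close> that by (simp add: mult_left_le)
    then show ?thesis
      using C[OF that] by linarith
  qed
  show ?thesis
  proof (rule that)
    fix u :: real
    assume "u \<noteq> 0"
    then show "\<bar>b u\<bar> \<le> C"
      using pos[of u] pos[of "- u"] even by (cases "u > 0") (auto simp: even_fun_def)
  qed
qed

lemma velocity_eq_0_iff: "m > 0 \<Longrightarrow> velocity m p = 0 \<longleftrightarrow> p = 0"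
  by (simp add: velocity_def)

lemma V0_at_momentum:
  assumes "p > 0"
  shows "V0 m b r (sqrt (p\<^sup>2 + m\<^sup>2)) = deviation_factor p b r (sqrt (p\<^sup>2 + m\<^sup>2))"
  using assms by (simp add: V0_def)

lemma V0_minus_at_momentum:
  assumes "p < 0"
  shows "V0_minus m b r (sqrt (p\<^sup>2 + m\<^sup>2)) = deviation_factor p b r (sqrt (p\<^sup>2 + m\<^sup>2))"
  using assms by (simp add: V0_minus_def)

lemma mat_mult_mat: "mat c ** mat d = (mat (c * d) :: 'a::semiring_1^'n^'n)"
  by (simp add: matrix_matrix_mult_def mat_def vec_eq_iff mult_delta_left)

text \<open>Taking \<eta> = p, with its sign, makes \<lambda> / \<eta> equal to 1 / s for momenta of
  either sign, so one computation serves both branches of the square root.\<close>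

lemma deviation_factor_eq_W0:
  fixes m p t :: real and b :: "real \<Rightarrow> real"
  defines "s \<equiv> velocity m p"
  assumes "s \<noteq> 0" and "t > 0"
    and int: "\<And>(x::real) (y::real). interval_lebesgue_integrable lborel x y b"
  shows "deviation_factor p b (t * s) (sqrt (p\<^sup>2 + m\<^sup>2)) =
    mat (exp (\<i> * of_real (1 / s * (LBINT u=1..s. b u)))) ** W0 m b t p"
proof -
  \<comment> \<open>The order of 1, s and t * s is not fixed, so additivity of the oriented integral
    requires integrability between the least and the greatest of them.\<close>
  have split: "(LBINT u=1..s. b u) + (LBINT u=s..t * s. b u) = (LBINT u=1..t * s. b u)"
    by (rule interval_integral_sum)
      (metis int one_ereal_def ereal_min ereal_max)
  have "s * (LBINT r=1..t. b (r * s)) = (LBINT u=s..t * s. b u)"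
    using interval_integral_mult_right_substitution[OF \<open>s \<noteq> 0\<close>, of 1 t b]
    by (simp add: one_ereal_def)
  with split \<open>s \<noteq> 0\<close> have "1 / s * (LBINT u=1..t * s. b u) =
      1 / s * (LBINT u=1..s. b u) + (LBINT r=1..t. b (r * s))"
    by (simp add: field_simps)
  moreover have "sqrt (p\<^sup>2 + m\<^sup>2) / p = 1 / s"
    by (simp add: s_def velocity_def)
  ultimately show ?thesis
    using \<open>t > 0\<close>
    by (simp only: deviation_factor_def W0_def mat_mult_mat s_def[symmetric] exp_add[symmetric]
        distrib_left[symmetric] of_real_add[symmetric] sgn_pos abs_of_pos mult_1_left)
qed

theorem mainTheorem4:
  fixes m \<alpha> \<gamma> :: real and a b :: "real \<Rightarrow> real"
  assumes "m > 0"
    and "even_fun a" and "even_fun b"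
    and "stationary_condition a b"
    and "dynamical_condition \<alpha> \<gamma> a b"
  shows "\<exists>C :: real \<Rightarrow> complex. \<forall>p. p \<noteq> 0 \<longrightarrow>
    cmod (C p) = 1 \<and>
    (\<forall>t>0.
      (p > 0 \<longrightarrow> V0 m b (t * velocity m p) (sqrt (p\<^sup>2 + m\<^sup>2)) = mat (C p) ** W0 m b t p) \<and>
      (p < 0 \<longrightarrow> V0_minus m b (t * velocity m p) (sqrt (p\<^sup>2 + m\<^sup>2)) = mat (C p) ** W0 m b t p))"
proof -
  have "twice_differentiable_pos b"
    using assms(5) by (simp add: dynamical_condition_def)
  then have cont: "continuous_on (- {0}) b"
    by (rule even_fun_continuous_on_punctured[OF assms(3)])
  obtain B where B: "\<And>u. u \<noteq> 0 \<Longrightarrow> \<bar>b u\<bar> \<le> B"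
    using dynamical_condition_bounded[OF assms(3,5)] by blast
  define C :: "real \<Rightarrow> complex" where
    "C p = exp (\<i> * of_real (1 / velocity m p * (LBINT u=1..velocity m p. b u)))" for p
  have "cmod (C p) = 1" for p
    unfolding C_def by (rule norm_exp_i_times)
  moreover have "deviation_factor p b (t * velocity m p) (sqrt (p\<^sup>2 + m\<^sup>2)) = mat (C p) ** W0 m b t p"
    if "p \<noteq> 0" and "t > 0" for p t
    unfolding C_def using that \<open>m > 0\<close>
    by (intro deviation_factor_eq_W0 interval_integrable_bounded_punctured[OF cont B])
      (simp_all add: velocity_eq_0_iff)
  ultimately show ?thesis
    by (intro exI[of _ C]) (simp add: V0_at_momentum V0_minus_at_momentum)
qed

end
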